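(* For every $n\ge 1$, the order of the semigroup $\operatorname{St}(P_n)$ is $$|\operatorname{St}(P_n)|=\sum_{k=0}^{\lfloor n/2\rfloor}\binom{n-k}{k}\binom{n-k+1}{k}\,k!.$$
   Context: $P_n$ is the path graph with vertex set $\{1,\dots,n\}$ and edges $\{i,i+1\}$, $1\le i<n$. For a finite simple graph $\Gamma=(V,E)$, the simplices are the singletons $\{v\}$ and the edges. A partial function $f:V\to V$ is continuous if for every simplex $\sigma$ the full preimage $\sigma f^{-1}$ is a simplex or empty. $\operatorname{St}(\Gamma)$ is the semigroup (under composition) of all continuous partial functions $f$ such that for every vertex $v$ the fiber $vf^{-1}$ is an edge or empty (the empty map is included). *)

theory Defs
  imports Complex_Main
begin

text \<open>A graph is a pair of a vertex set and a set of edges, each edge being a set of vertices.\<close>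

type_synonym 'a graph = "'a set \<times> 'a set set"

definition finite_simple_graph :: "'a graph \<Rightarrow> bool" where
  "finite_simple_graph G \<longleftrightarrow>
     finite (fst G) \<and> (\<forall>e \<in> snd G. e \<subseteq> fst G \<and> card e = 2)"

definition path_graph :: "nat \<Rightarrow> nat graph" where
  "path_graph n = ({1..n}, {{i, i + 1} | i. 1 \<le> i \<and> i < n})"

definition simplices :: "'a graph \<Rightarrow> 'a set set" where
  "simplices G = {{v} | v. v \<in> fst G} \<union> snd G"

text \<open>The full preimage of a set under a partial function.\<close>

definition preimage :: "('a \<rightharpoonup> 'b) \<Rightarrow> 'b set \<Rightarrow> 'a set" where
  "preimage f S = {x. \<exists>y \<in> S. f x = Some y}"

text \<open>A partial function on the vertex set is a map whose domain and range lie in the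
  vertex set, so that distinct maps are distinct partial functions.\<close>

definition partial_functions :: "'a set \<Rightarrow> ('a \<rightharpoonup> 'a) set" where
  "partial_functions V = {f. dom f \<subseteq> V \<and> ran f \<subseteq> V}"

definition continuous_pfun :: "'a graph \<Rightarrow> ('a \<rightharpoonup> 'a) \<Rightarrow> bool" where
  "continuous_pfun G f \<longleftrightarrow>
     f \<in> partial_functions (fst G) \<and>
     (\<forall>s \<in> simplices G. preimage f s \<in> simplices G \<or> preimage f s = {})"

definition St :: "'a graph \<Rightarrow> ('a \<rightharpoonup> 'a) set" where
  "St G = {f. continuous_pfun G f \<and>
              (\<forall>v \<in> fst G. preimage f {v} \<in> snd G \<or> preimage f {v} = {})}"

lemma finite_simple_graph_path_graph: "finite_simple_graph (path_graph n)"
  by (auto simp: finite_simple_graph_def path_graph_def)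

lemma empty_in_St: "Map.empty \<in> St G"
  by (auto simp: St_def continuous_pfun_def partial_functions_def preimage_def)

lemma preimage_map_comp: "preimage (g \<circ>\<^sub>m f) S = preimage f (preimage g S)"
  by (auto simp: preimage_def map_comp_def split: option.splits)

lemma preimage_empty [simp]: "preimage f {} = {}"
  by (simp add: preimage_def)

text \<open>Maps act on the right in the notation \<open>\<sigma> f\<^sup>-\<^sup>1\<close>, so the product \<open>f g\<close> is
  \<open>g \<circ>\<^sub>m f\<close>. Closure under it makes \<open>St G\<close> a semigroup.\<close>

lemma St_closed_comp:
  assumes G: "finite_simple_graph G" and f: "f \<in> St G" and g: "g \<in> St G"
  shows "g \<circ>\<^sub>m f \<in> St G"
proof -
  have edge: "preimage f e \<in> snd G \<or> preimage f e = {}" if e: "e \<in> snd G" for e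
  proof -
    have "card e = 2" "e \<subseteq> fst G"
      using G e by (auto simp: finite_simple_graph_def)
    then obtain a b where ab: "e = {a, b}" "a \<in> fst G" "b \<in> fst G"
      by (auto simp: card_2_iff)
    have un: "preimage f e = preimage f {a} \<union> preimage f {b}"
      using ab by (auto simp: preimage_def)
    have fib: "preimage f {v} \<in> snd G \<or> preimage f {v} = {}" if "v \<in> fst G" for v
      using f that by (auto simp: St_def)
    have simp: "preimage f e \<in> simplices G \<or> preimage f e = {}"
      using f e by (auto simp: St_def continuous_pfun_def simplices_def)
    have no_singleton: "preimage f e \<noteq> {x}" for x
    proof
      assume eq: "preimage f e = {x}"
      have "preimage f {v} = {}" if "v \<in> {a, b}" for v
      proof (rule ccontr)
        assume "preimage f {v} \<noteq> {}"
        with fib that ab have "preimage f {v} \<in> snd G" by blast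
        then have c: "card (preimage f {v}) = 2"
          using G by (auto simp: finite_simple_graph_def)
        have "preimage f {v} \<subseteq> {x}" using un eq that by blast
        then have "card (preimage f {v}) \<le> card {x}" by (intro card_mono) auto
        with c show False by simp
      qed
      then show False using un eq by auto
    qed
    show ?thesis using simp no_singleton by (auto simp: simplices_def)
  qed
  have pf: "g \<circ>\<^sub>m f \<in> partial_functions (fst G)"
  proof -
    have d: "dom f \<subseteq> fst G" "ran g \<subseteq> fst G"
      using f g by (auto simp: St_def continuous_pfun_def partial_functions_def)
    have "dom (g \<circ>\<^sub>m f) \<subseteq> dom f" "ran (g \<circ>\<^sub>m f) \<subseteq> ran g"
      by (auto simp: map_comp_def ran_def split: option.splits)
    with d have "dom (g \<circ>\<^sub>m f) \<subseteq> fst G" "ran (g \<circ>\<^sub>m f) \<subseteq> fst G"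
      by (blast intro: subset_trans)+
    then show ?thesis unfolding partial_functions_def by blast
  qed
  have cont: "preimage h s \<in> simplices G \<or> preimage h s = {}"
    if "h \<in> St G" "s \<in> simplices G" for h s
    using that by (auto simp: St_def continuous_pfun_def)
  have "preimage (g \<circ>\<^sub>m f) s \<in> simplices G \<or> preimage (g \<circ>\<^sub>m f) s = {}"
    if "s \<in> simplices G" for s
    unfolding preimage_map_comp using cont[OF g that] cont[OF f] by fastforce
  moreover have "preimage (g \<circ>\<^sub>m f) {v} \<in> snd G \<or> preimage (g \<circ>\<^sub>m f) {v} = {}"
    if "v \<in> fst G" for v
  proof -
    have "preimage g {v} \<in> snd G \<or> preimage g {v} = {}"
      using g that by (auto simp: St_def)
    then show ?thesis unfolding preimage_map_comp using edge by fastforce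
  qed
  ultimately show ?thesis using pf by (auto simp: St_def continuous_pfun_def)
qed

end

theory Submission
  imports Defs "HOL-Library.FuncSet"
begin

text \<open>
  In a member \<open>f\<close> of \<open>St P\<^sub>n\<close> every nonempty fibre is an edge \<open>{i, i + 1}\<close>, and distinct fibres are
  disjoint. If two adjacent vertices \<open>v\<close>, \<open>v + 1\<close> both had a nonempty fibre, the preimage of the
  edge \<open>{v, v + 1}\<close> would have four elements and could not be a simplex. So \<open>f\<close> amounts to a
  bijection from a set of disjoint edges of the path onto a set of pairwise non-adjacent vertices,
  and conversely every such bijection gives a member of \<open>St P\<^sub>n\<close>.

  An edge \<open>{i, i + 1}\<close> is recorded by its left end \<open>i \<in> {1..<n}\<close>; two edges are disjoint exactly
  when their left ends are distinct and not consecutive. Hence both sides of the bijection are sets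
  without consecutive elements, inside \<open>{1..<n}\<close> and \<open>{1..<n + 1}\<close> respectively. There are
  \<open>(n - k) choose k\<close> and \<open>(n - k + 1) choose k\<close> such sets of size \<open>k\<close>
  (\<open>card_sparse_subsets\<close>) and \<open>fact k\<close> bijections between two of them
  (\<open>card_partial_bijections\<close>). The correspondence itself is \<open>bij_betw_double_edges\<close>.
\<close>

section \<open>Sets without consecutive elements\<close>

definition sparse :: "nat set \<Rightarrow> bool" where
  "sparse A \<longleftrightarrow> (\<forall>x \<in> A. Suc x \<notin> A)"

definition sparse_subsets :: "nat \<Rightarrow> nat \<Rightarrow> nat set set" where
  "sparse_subsets N k = {A. A \<subseteq> {1..<N} \<and> sparse A \<and> card A = k}"

lemma finite_sparse_subsets: "finite (sparse_subsets N k)"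
  by (rule finite_subset[of _ "Pow {1..<N}"]) (auto simp: sparse_subsets_def)

lemma sparse_subsets_0: "sparse_subsets N 0 = {{}}"
  by (auto simp: sparse_subsets_def sparse_def finite_subset card_eq_0_iff)

text \<open>The cases are whether \<open>N + 1\<close> is an element. If it is, sparseness excludes \<open>N\<close>, which
  is why the remaining elements lie in \<open>{1..<N}\<close>. Taking cardinalities turns this into Pascal's
  rule for \<open>(N - k) choose k\<close>.\<close>

lemma sparse_subsets_rec:
  "sparse_subsets (Suc (Suc N)) (Suc k) =
     sparse_subsets (Suc N) (Suc k) \<union> insert (Suc N) ` sparse_subsets N k"
  (is "?L = ?R1 \<union> ?R2")
proof
  show "?L \<subseteq> ?R1 \<union> ?R2"
  proof
    fix A assume A: "A \<in> ?L"
    then have fin: "finite A" and sub: "A \<subseteq> {1..<Suc (Suc N)}" and sp: "sparse A"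
      and card: "card A = Suc k"
      by (auto simp: sparse_subsets_def finite_subset)
    show "A \<in> ?R1 \<union> ?R2"
    proof (cases "Suc N \<in> A")
      case True
      let ?B = "A - {Suc N}"
      have "N \<notin> A" using True sp by (auto simp: sparse_def)
      have "x \<in> {1..<N}" if "x \<in> ?B" for x
      proof -
        have "x \<in> {1..<Suc (Suc N)}" "x \<noteq> Suc N" "x \<noteq> N"
          using sub that \<open>N \<notin> A\<close> by auto
        then show ?thesis by simp
      qed
      then have "?B \<subseteq> {1..<N}" by blast
      moreover have "sparse ?B" using sp by (auto simp: sparse_def)
      moreover have "card ?B = k" using True fin card by simp
      ultimately have "?B \<in> sparse_subsets N k" by (simp add: sparse_subsets_def)
      moreover have "A = insert (Suc N) ?B" using True by auto
      ultimately show ?thesis by blast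
    next
      case False
      have "x \<in> {1..<Suc N}" if "x \<in> A" for x
      proof -
        have "x \<in> {1..<Suc (Suc N)}" "x \<noteq> Suc N" using sub that False by auto
        then show ?thesis by simp
      qed
      then have "A \<subseteq> {1..<Suc N}" by blast
      then show ?thesis using sp card by (simp add: sparse_subsets_def)
    qed
  qed
  have "insert (Suc N) B \<in> ?L" if B: "B \<in> sparse_subsets N k" for B
  proof -
    have sub: "B \<subseteq> {1..<N}" and "card B = k" and sp: "sparse B"
      using B by (auto simp: sparse_subsets_def)
    have "finite B" "Suc N \<notin> B" "N \<notin> B" "Suc (Suc N) \<notin> B"
      using sub by (auto intro: finite_subset)
    then show ?thesis using sub sp \<open>card B = k\<close>
      by (auto simp: sparse_subsets_def sparse_def)
  qed
  then show "?R1 \<union> ?R2 \<subseteq> ?L"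
    by (auto simp: sparse_subsets_def)
qed

lemma card_sparse_subsets: "card (sparse_subsets N k) = (N - k) choose k"
proof (induction N arbitrary: k rule: induct_nat_012)
  case 0
  show ?case by (cases k) (auto simp: sparse_subsets_0, auto simp: sparse_subsets_def)
next
  case 1
  show ?case by (cases k) (auto simp: sparse_subsets_0, auto simp: sparse_subsets_def)
next
  case (ge2 N)
  show ?case
  proof (cases k)
    case 0
    then show ?thesis by (simp add: sparse_subsets_0)
  next
    case (Suc j)
    have inj: "inj_on (insert (Suc N)) (sparse_subsets N j)"
      by (rule inj_onI) (metis (no_types, lifting) Diff_insert_absorb atLeastLessThan_iff
          insert_absorb less_Suc_eq mem_Collect_eq not_less_iff_gr_or_eq sparse_subsets_def subsetD)
    have "sparse_subsets (Suc N) (Suc j) \<inter> insert (Suc N) ` sparse_subsets N j = {}"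
      by (auto simp: sparse_subsets_def)
    then have "card (sparse_subsets (Suc (Suc N)) k) =
        card (sparse_subsets (Suc N) (Suc j)) + card (sparse_subsets N j)"
      using inj unfolding Suc sparse_subsets_rec
      by (subst card_Un_disjoint) (auto simp: finite_sparse_subsets card_image)
    also have "\<dots> = ((N - j) choose Suc j) + ((N - j) choose j)"
      using ge2 by simp
    also have "\<dots> = (Suc (Suc N) - k) choose k"
      using Suc by (cases "j \<le> N") (auto simp: Suc_diff_le)
    finally show ?thesis .
  qed
qed

section \<open>Partial bijections between finite sets\<close>

lemma card_partial_bijections:
  assumes "finite A" "finite B" "card A = k" "card B = k"
  shows "card {g. dom g = A \<and> ran g = B \<and> inj_on g A} = fact k"
proof -
  let ?F = "{h \<in> A \<rightarrow>\<^sub>E B. inj_on h A}"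
  let ?G = "{g. dom g = A \<and> ran g = B \<and> inj_on g A}"
  have "bij_betw (\<lambda>h x. if x \<in> A then Some (h x) else None) ?F ?G"
  proof (rule bij_betwI[where g = "\<lambda>g. restrict (\<lambda>x. the (g x)) A"])
    show "(\<lambda>h x. if x \<in> A then Some (h x) else None) \<in> ?F \<rightarrow> ?G"
    proof
      fix h assume h: "h \<in> ?F"
      \<comment> \<open>an injection into a finite set of the same size is onto\<close>
      then have "h ` A = B"
        using assms by (intro card_subset_eq) (auto simp: card_image)
      then show "(\<lambda>x. if x \<in> A then Some (h x) else None) \<in> ?G"
        using h by (auto simp: ran_def dom_def inj_on_def split: if_splits)
    qed
    show "(\<lambda>g. restrict (\<lambda>x. the (g x)) A) \<in> ?G \<rightarrow> ?F"
      by (auto simp: inj_on_def ran_def dom_def)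
    show "restrict (\<lambda>x. the (if x \<in> A then Some (h x) else None)) A = h" if "h \<in> ?F" for h
      using that by (intro ext) (auto simp: restrict_def PiE_def extensional_def)
    show "(\<lambda>x. if x \<in> A then Some (restrict (\<lambda>x. the (g x)) A x) else None) = g"
      if "g \<in> ?G" for g
      using that by (intro ext) (auto simp: restrict_def domIff)
  qed
  then have "card ?G = card ?F" by (rule bij_betw_same_card[symmetric])
  also have "\<dots> = fact k"
    using card_inj_on_subset_funcset[OF assms(1,2) subset_refl] assms(3,4)
    by (simp add: fact_prod_rev atLeast0LessThan)
  finally show ?thesis .
qed

section \<open>Matchings of the path and their images\<close>

text \<open>The domain is the set of left ends of a matching of the path, and the value at \<open>i\<close> is
  the common image of both ends of the edge \<open>{i, i + 1}\<close>. Sparseness of the domain says that the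
  edges are disjoint.\<close>

definition edge_maps :: "nat \<Rightarrow> (nat \<rightharpoonup> nat) set" where
  "edge_maps n = {g. dom g \<subseteq> {1..<n} \<and> ran g \<subseteq> {1..n} \<and> sparse (dom g) \<and> sparse (ran g)
     \<and> inj_on g (dom g)}"

lemma card_edge_maps:
  "card (edge_maps n) =
     (\<Sum>k = 0..n div 2. ((n - k) choose k) * ((n - k + 1) choose k) * fact k)"
proof -
  let ?P = "\<lambda>k. sparse_subsets n k \<times> sparse_subsets (Suc n) k"
  let ?G = "\<lambda>AB. {g. dom g = fst AB \<and> ran g = snd AB \<and> inj_on g (fst AB)}"
  let ?T = "SIGMA k:{0..n div 2}. SIGMA AB:?P k. ?G AB"
  have cardG: "card (?G AB) = fact k" if "AB \<in> ?P k" for AB k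
  proof (rule card_partial_bijections)
    have "fst AB \<subseteq> {1..<n}" "snd AB \<subseteq> {1..<Suc n}"
      using that by (auto simp: sparse_subsets_def)
    then show "finite (fst AB)" "finite (snd AB)"
      by (blast intro: finite_subset finite_atLeastLessThan)+
  qed (use that in \<open>auto simp: sparse_subsets_def\<close>)
  then have finG: "finite (?G AB)" if "AB \<in> ?P k" for AB k
    using that by (metis (no_types, lifting) card.infinite fact_nonzero)
  have finP: "finite (?P k)" for k
    by (simp add: finite_sparse_subsets)
  let ?c = "\<lambda>g. (card (dom g), (dom g, ran g), g)"
  have "?c ` edge_maps n = ?T"
  proof
    show "?c ` edge_maps n \<subseteq> ?T"
    proof (rule image_subsetI)
      fix g assume g: "g \<in> edge_maps n"
      let ?k = "card (dom g)"
      have ran: "Some ` ran g = g ` dom g"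
        by (force simp: ran_def dom_def image_iff)
      have "card (ran g) = card (g ` dom g)"
        by (metis ran card_image inj_Some)
      also have "\<dots> = ?k"
        using g by (simp add: edge_maps_def card_image)
      finally have AB: "(dom g, ran g) \<in> ?P ?k"
        using g by (auto simp: edge_maps_def sparse_subsets_def)
      \<comment> \<open>a set of this size exists, so its binomial coefficient does not vanish\<close>
      have "(n - ?k) choose ?k \<noteq> 0"
        using AB card_sparse_subsets[of n ?k] finite_sparse_subsets[of n ?k]
        by (metis SigmaD1 card_0_eq empty_iff)
      then have "?k \<le> n - ?k" by (metis binomial_eq_0 not_le)
      then have "?k \<le> n div 2" by simp
      then show "?c g \<in> ?T" using AB g by (auto simp: edge_maps_def)
    qed
    show "?T \<subseteq> ?c ` edge_maps n"
    proof
      fix t assume "t \<in> ?T"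
      then obtain k g where "t = (k, (dom g, ran g), g)" "dom g \<in> sparse_subsets n k"
        "ran g \<in> sparse_subsets (Suc n) k" "inj_on g (dom g)"
        by auto
      then show "t \<in> ?c ` edge_maps n"
        by (intro image_eqI[of _ _ g]) (auto simp: edge_maps_def sparse_subsets_def)
    qed
  qed
  moreover have "inj_on ?c (edge_maps n)" by (rule inj_onI) simp
  ultimately have "card (edge_maps n) = card ?T" using card_image by fastforce
  also have "\<dots> = (\<Sum>k = 0..n div 2. \<Sum>AB \<in> ?P k. card (?G AB))"
  proof -
    have fin: "\<forall>AB \<in> ?P k. finite (?G AB)" for k
      using finG by blast
    then have "\<forall>k \<in> {0..n div 2}. finite (SIGMA AB:?P k. ?G AB)"
      by (intro ballI finite_SigmaI finP) (rule bspec)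
    then have "card ?T = (\<Sum>k = 0..n div 2. card (SIGMA AB:?P k. ?G AB))"
      by (intro card_SigmaI finite_atLeastAtMost)
    also have "\<dots> = (\<Sum>k = 0..n div 2. \<Sum>AB \<in> ?P k. card (?G AB))"
      by (intro sum.cong refl card_SigmaI finP fin)
    finally show ?thesis .
  qed
  also have "\<dots> = (\<Sum>k = 0..n div 2. \<Sum>AB \<in> ?P k. fact k)"
    by (intro sum.cong refl cardG)
  also have "\<dots> = (\<Sum>k = 0..n div 2. ((n - k) choose k) * ((n - k + 1) choose k) * fact k)"
    by (intro sum.cong)
       (auto simp: card_cartesian_product card_sparse_subsets Suc_diff_le)
  finally show ?thesis .
qed

text \<open>At \<open>x = 0\<close> the truncated \<open>x - 1\<close> is \<open>0\<close> again, so that no value appears there when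
  \<open>0\<close> is outside the domain of \<open>g\<close>.\<close>

definition double_edges :: "(nat \<rightharpoonup> nat) \<Rightarrow> (nat \<rightharpoonup> nat)" where
  "double_edges g = (\<lambda>x. case g x of None \<Rightarrow> g (x - 1) | Some y \<Rightarrow> Some y)"

definition left_ends :: "(nat \<rightharpoonup> nat) \<Rightarrow> (nat \<rightharpoonup> nat)" where
  "left_ends f = (\<lambda>x. if f x = f (Suc x) then f x else None)"

lemma double_edges_eq_Some:
  assumes "g \<in> edge_maps n"
  shows "double_edges g x = Some v \<longleftrightarrow> g x = Some v \<or> (\<exists>i. x = Suc i \<and> g i = Some v)"
proof (cases x)
  case 0
  then show ?thesis by (simp add: double_edges_def split: option.splits)
next
  case (Suc i)
  have "g i = None \<or> g (Suc i) = None"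
    using assms by (force simp: edge_maps_def sparse_def)
  then show ?thesis using Suc by (auto simp: double_edges_def split: option.splits)
qed

lemma fibre_double_edges:
  assumes g: "g \<in> edge_maps n" and "g i = Some v"
  shows "preimage (double_edges g) {v} = {i, i + 1}"
proof -
  have "j = i" if "g j = Some v" for j
    using g that assms(2) by (auto simp: edge_maps_def inj_on_def dom_def)
  then have "g j = Some v \<longleftrightarrow> j = i" for j
    using assms(2) by blast
  then show ?thesis
    by (auto simp: preimage_def double_edges_eq_Some[OF g])
qed

lemma fibre_double_edges_empty:
  assumes "g \<in> edge_maps n" and "v \<notin> ran g"
  shows "preimage (double_edges g) {v} = {}"
  using assms(2) by (auto simp: preimage_def double_edges_eq_Some[OF assms(1)] ran_def)

lemma double_edges_in_St:
  assumes g: "g \<in> edge_maps n"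
  shows "double_edges g \<in> St (path_graph n)"
proof -
  let ?f = "double_edges g" and ?E = "snd (path_graph n)"
  have bounds: "1 \<le> i \<and> i < n \<and> 1 \<le> v \<and> v \<le> n" if "g i = Some v" for i v
  proof -
    have "i \<in> dom g" "v \<in> ran g" using that by (auto simp: ran_def)
    then show ?thesis using g by (force simp: edge_maps_def)
  qed
  have fib: "preimage ?f {v} \<in> ?E \<or> preimage ?f {v} = {}" for v
  proof (cases "v \<in> ran g")
    case True
    then obtain i where i: "g i = Some v" by (auto simp: ran_def)
    show ?thesis
      using fibre_double_edges[OF g i] bounds[OF i] by (auto simp: path_graph_def)
  next
    case False
    then show ?thesis using fibre_double_edges_empty[OF g] by blast
  qed
  have "preimage ?f {v, v + 1} \<in> ?E \<or> preimage ?f {v, v + 1} = {}" for v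
  proof -
    \<comment> \<open>the range is sparse, so only one of the two fibres can be nonempty\<close>
    have "v \<notin> ran g \<or> v + 1 \<notin> ran g"
      using g by (auto simp: edge_maps_def sparse_def)
    then have "preimage ?f {v} = {} \<or> preimage ?f {v + 1} = {}"
      using fibre_double_edges_empty[OF g] by blast
    moreover have "preimage ?f {v, v + 1} = preimage ?f {v} \<union> preimage ?f {v + 1}"
      by (auto simp: preimage_def)
    ultimately show ?thesis using fib[of v] fib[of "v + 1"] by auto
  qed
  then have edge: "preimage ?f e \<in> ?E \<or> preimage ?f e = {}" if "e \<in> ?E" for e
    using that by (auto simp: path_graph_def)
  have "?f \<in> partial_functions (fst (path_graph n))"
    using bounds
    by (fastforce simp: partial_functions_def path_graph_def ran_def double_edges_eq_Some[OF g])
  then show ?thesis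
    using fib edge by (auto simp: St_def continuous_pfun_def simplices_def)
qed

lemma St_fibre:
  assumes "f \<in> St (path_graph n)" and "f x = Some v"
  obtains i where "1 \<le> i" "i < n" "1 \<le> v" "v \<le> n" "\<And>y. f y = Some v \<longleftrightarrow> y = i \<or> y = Suc i"
proof -
  have "ran f \<subseteq> fst (path_graph n)"
    using assms(1) by (simp add: St_def continuous_pfun_def partial_functions_def)
  then have v: "v \<in> fst (path_graph n)" using assms(2) by (auto simp: ran_def)
  have "x \<in> preimage f {v}" using assms(2) by (simp add: preimage_def)
  then have "preimage f {v} \<in> snd (path_graph n)"
    using assms(1) v by (auto simp: St_def)
  then obtain i where i: "1 \<le> i" "i < n" "preimage f {v} = {i, i + 1}"
    by (auto simp: path_graph_def)
  have "f y = Some v \<longleftrightarrow> y = i \<or> y = Suc i" for y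
    using i(3) by (auto simp: preimage_def set_eq_iff)
  then show thesis using that[of i] i v by (simp add: path_graph_def)
qed

lemma left_ends_eq_Some:
  "left_ends f x = Some v \<longleftrightarrow> f x = Some v \<and> f (Suc x) = Some v"
  by (auto simp: left_ends_def)

lemma left_ends_in_edge_maps:
  assumes f: "f \<in> St (path_graph n)"
  shows "left_ends f \<in> edge_maps n"
proof -
  let ?g = "left_ends f"
  have left: "1 \<le> x \<and> x < n \<and> 1 \<le> v \<and> v \<le> n \<and> (\<forall>y. f y = Some v \<longleftrightarrow> y = x \<or> y = Suc x)"
    if "?g x = Some v" for x v
  proof -
    have *: "f x = Some v" "f (Suc x) = Some v"
      using that by (auto simp: left_ends_eq_Some)
    obtain i where i: "1 \<le> i" "i < n" "1 \<le> v" "v \<le> n"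
      "\<And>y. f y = Some v \<longleftrightarrow> y = i \<or> y = Suc i"
      using St_fibre[OF f *(1)] by blast
    have "x = i" using * unfolding i(5) by auto
    then show ?thesis using i by simp
  qed
  have "dom ?g \<subseteq> {1..<n}" "ran ?g \<subseteq> {1..n}"
    using left by (auto simp: ran_def Suc_le_eq)
  moreover have "inj_on ?g (dom ?g)"
  proof (rule inj_onI)
    fix x y assume "x \<in> dom ?g" "?g x = ?g y"
    then obtain v where "?g x = Some v" "?g y = Some v" by (metis domD)
    then show "x = y" using left[of x v] left[of y v] by (metis Suc_n_not_le_n le_SucI order_refl)
  qed
  moreover have "sparse (dom ?g)"
    unfolding sparse_def
  proof (intro ballI notI)
    fix x assume "x \<in> dom ?g" "Suc x \<in> dom ?g"
    then obtain v w where vw: "?g x = Some v" "?g (Suc x) = Some w" by auto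
    then have "f (Suc (Suc x)) = Some v" by (auto simp: left_ends_eq_Some)
    then show False using left[OF vw(1)] by auto
  qed
  moreover have "sparse (ran ?g)"
    unfolding sparse_def
  proof (intro ballI notI)
    fix v assume "v \<in> ran ?g" "Suc v \<in> ran ?g"
    then obtain x y where xy: "?g x = Some v" "?g y = Some (Suc v)" by (auto simp: ran_def)
    \<comment> \<open>two disjoint fibres would make the preimage of an edge too large for a simplex\<close>
    have "1 \<le> v" "v < n" using left[OF xy(1)] left[OF xy(2)] by auto
    then have "{v, Suc v} \<in> simplices (path_graph n)"
      by (auto simp: simplices_def path_graph_def)
    then have "preimage f {v, Suc v} \<in> simplices (path_graph n) \<or> preimage f {v, Suc v} = {}"
      using f by (simp add: St_def continuous_pfun_def)
    then have "card (preimage f {v, Suc v}) \<le> 2" 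
      by (auto simp: simplices_def path_graph_def)
    moreover have "preimage f {v, Suc v} = {x, Suc x} \<union> {y, Suc y}"
      using left[OF xy(1)] left[OF xy(2)] by (auto simp: preimage_def)
    moreover have "{x, Suc x} \<inter> {y, Suc y} = {}"
      using xy by (auto simp: left_ends_eq_Some)
    then have "card ({x, Suc x} \<union> {y, Suc y}) = 4"
      by (subst card_Un_disjoint) auto
    ultimately show False by simp
  qed
  ultimately show ?thesis by (simp add: edge_maps_def)
qed

lemma left_ends_double_edges:
  assumes g: "g \<in> edge_maps n"
  shows "left_ends (double_edges g) = g"
proof -
  have "left_ends (double_edges g) x = Some v \<longleftrightarrow> g x = Some v" for x v
  proof
    assume "left_ends (double_edges g) x = Some v"
    then have x: "x \<in> preimage (double_edges g) {v}" "Suc x \<in> preimage (double_edges g) {v}"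
      by (auto simp: left_ends_eq_Some preimage_def)
    then have "v \<in> ran g" using fibre_double_edges_empty[OF g] by blast
    then obtain i where i: "g i = Some v" by (auto simp: ran_def)
    then have "x = i" using x fibre_double_edges[OF g i] by auto
    then show "g x = Some v" using i by simp
  qed (simp add: left_ends_eq_Some double_edges_eq_Some[OF g])
  then show ?thesis by (metis ext not_Some_eq)
qed

lemma double_edges_left_ends:
  assumes f: "f \<in> St (path_graph n)"
  shows "double_edges (left_ends f) = f"
proof -
  have "double_edges (left_ends f) x = Some v \<longleftrightarrow> f x = Some v" for x v
  proof
    assume "f x = Some v"
    then obtain i where "\<And>y. f y = Some v \<longleftrightarrow> y = i \<or> y = Suc i"
      using St_fibre[OF f] by metis
    then show "double_edges (left_ends f) x = Some v"
      using \<open>f x = Some v\<close>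
      unfolding double_edges_eq_Some[OF left_ends_in_edge_maps[OF f]] left_ends_eq_Some by auto
  qed (auto simp: double_edges_eq_Some[OF left_ends_in_edge_maps[OF f]] left_ends_eq_Some)
  then show ?thesis by (metis ext not_Some_eq)
qed

lemma bij_betw_double_edges: "bij_betw double_edges (edge_maps n) (St (path_graph n))"
  by (rule bij_betwI[where g = left_ends])
     (auto simp: double_edges_in_St left_ends_in_edge_maps left_ends_double_edges
        double_edges_left_ends)

theorem mainTheorem5:
  fixes n :: nat
  assumes "n \<ge> 1"
  shows "card (St (path_graph n)) =
    (\<Sum>k = 0..n div 2. ((n - k) choose k) * ((n - k + 1) choose k) * fact k)"
  using bij_betw_same_card[OF bij_betw_double_edges[of n]] card_edge_maps[of n] by simp

end
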